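(* Let $k_1,k_2\ge1$ be integers. For all $n\ge k_1+k_2$, $$P_{q,\theta}(\overline W_L=n)=\overline P^{(1)}_{q,L}(n)+\overline P^{(0)}_{q,L}(n),$$ where $$\overline P^{(1)}_{q,L}(n)=\theta^{k_1}\prod_{j=1}^{n-k_1}(1-\theta q^{j-1})\sum_{s=1}^{k_1}\Big[\overline I_q(k_1,n-k_1,s)+\overline J_q(k_1,n-k_1,s)\Big]$$ and $$\overline P^{(0)}_{q,L}(n)=\theta^{n-k_2}\prod_{j=1}^{k_2}(1-\theta q^{j-1})\sum_{s=1}^{k_2}\Big[\overline K_q(n-k_2,k_2,s)+\overline L_q(n-k_2,k_2,s)\Big].$$
   Context: Model: fix reals $0\le\theta\le1$ and $0<q<1$. $(X_j)_{j\ge1}$ is a sequence of $\{0,1\}$-valued random variables (1 = success, 0 = failure) with law $P_{q,\theta}$ such that, conditionally on $X_1,\dots,X_{j-1}$ containing exactly $i-1$ zeros, $X_j=0$ with probability $1-\theta q^{i-1}$ and $X_j=1$ with probability $\theta q^{i-1}$. Conventions: $0^0=1$, empty products are 1, empty sums are 0. Waiting times: $N_1$ is the trial at which the $k_1$-th success (in total) occurs and $N_0$ the trial at which the $k_2$-th failure (in total) occurs ($\infty$ if it does not occur). $\overline W_L=\max(N_1,N_0)$ (frequency quotas on both, later case); $\overline P^{(1)}_{q,L}(n)=P_{q,\theta}(N_1=n,\ N_0<n)$ and $\overline P^{(0)}_{q,L}(n)=P_{q,\theta}(N_0=n,\ N_1<n)$. Combinatorial sums, for integers $u,v$ and $s\ge1$,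 all variables being positive integers with $\sum x_j=u$ and $\sum y_j=v$ (a family of zero variables consists of the single empty tuple, with sum $0$): - $\overline I_q(u,v,s)=\sum q^{\sum_{j=2}^{s}(y_1+\dots+y_{j-1})x_j}$ over $(x_1,\dots,x_s)$, $(y_1,\dots,y_{s-1})$; - $\overline J_q(u,v,s)=\sum q^{\sum_{j=1}^{s}(y_1+\dots+y_j)x_j}$ over $(x_1,\dots,x_s)$, $(y_1,\dots,y_s)$; - $\overline K_q(u,v,s)=\sum q^{\sum_{j=1}^{s-1}(y_1+\dots+y_j)x_j}$ over $(x_1,\dots,x_{s-1})$, $(y_1,\dots,y_s)$; - $\overline L_q(u,v,s)=\sum q^{\sum_{j=2}^{s}(y_1+\dots+y_{j-1})x_j}$ over $(x_1,\dots,x_s)$, $(y_1,\dots,y_s)$. *)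

theory Defs
  imports "HOL-Probability.Probability" "HOL-Library.Extended_Nat"
begin

text \<open>
  The sequence is indexed from 1; the value \<^term>\<open>X 0\<close> plays no role. The success probability at
  trial \<open>j\<close> is prescribed conditionally on the complete history \<open>X 1 = x 1, \<dots>, X (j - 1) = x (j - 1)\<close>;
  histories of probability 0 impose no condition.
\<close>

locale q_bernoulli_trials = prob_space M
  for M :: "'a measure" +
  fixes X :: "nat \<Rightarrow> 'a \<Rightarrow> nat" and q \<theta> :: real
  assumes X_measurable: "\<And>j. 1 \<le> j \<Longrightarrow> random_variable (count_space UNIV) (X j)"
    and X_binary: "\<And>j \<omega>. 1 \<le> j \<Longrightarrow> \<omega> \<in> space M \<Longrightarrow> X j \<omega> \<in> {0, 1}"
    and cond_failure:
      "\<And>j x. 1 \<le> j \<Longrightarrow> \<P>(\<omega> in M. \<forall>l\<in>{1..<j}. X l \<omega> = x l) > 0 \<Longrightarrow>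
        \<P>(\<omega> in M. X j \<omega> = 0 \<bar> \<forall>l\<in>{1..<j}. X l \<omega> = x l) = 1 - \<theta> * q ^ card {l\<in>{1..<j}. x l = 0}"
    and cond_success:
      "\<And>j x. 1 \<le> j \<Longrightarrow> \<P>(\<omega> in M. \<forall>l\<in>{1..<j}. X l \<omega> = x l) > 0 \<Longrightarrow>
        \<P>(\<omega> in M. X j \<omega> = 1 \<bar> \<forall>l\<in>{1..<j}. X l \<omega> = x l) = \<theta> * q ^ card {l\<in>{1..<j}. x l = 0}"

text \<open>
  The trial at which the \<open>k\<close>-th occurrence of the value \<open>b\<close> takes place. The set below has at most
  one element, and \<^term>\<open>Inf {} = (\<infinity> :: enat)\<close> covers the case that there is no such trial.
\<close>

definition occurrence_time :: "nat \<Rightarrow> nat \<Rightarrow> (nat \<Rightarrow> nat) \<Rightarrow> enat" where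
  "occurrence_time b k x = Inf (enat ` {n. 1 \<le> n \<and> x n = b \<and> card {j\<in>{1..n}. x j = b} = k})"

definition N1 :: "(nat \<Rightarrow> 'a \<Rightarrow> nat) \<Rightarrow> nat \<Rightarrow> 'a \<Rightarrow> enat" where
  "N1 X k1 \<omega> = occurrence_time 1 k1 (\<lambda>j. X j \<omega>)"

definition N0 :: "(nat \<Rightarrow> 'a \<Rightarrow> nat) \<Rightarrow> nat \<Rightarrow> 'a \<Rightarrow> enat" where
  "N0 X k2 \<omega> = occurrence_time 0 k2 (\<lambda>j. X j \<omega>)"

definition W_L :: "(nat \<Rightarrow> 'a \<Rightarrow> nat) \<Rightarrow> nat \<Rightarrow> nat \<Rightarrow> 'a \<Rightarrow> enat" where
  "W_L X k1 k2 \<omega> = max (N1 X k1 \<omega>) (N0 X k2 \<omega>)"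

definition P1_L :: "'a measure \<Rightarrow> (nat \<Rightarrow> 'a \<Rightarrow> nat) \<Rightarrow> nat \<Rightarrow> nat \<Rightarrow> nat \<Rightarrow> real" where
  "P1_L M X k1 k2 n = \<P>(\<omega> in M. N1 X k1 \<omega> = enat n \<and> N0 X k2 \<omega> < enat n)"

definition P0_L :: "'a measure \<Rightarrow> (nat \<Rightarrow> 'a \<Rightarrow> nat) \<Rightarrow> nat \<Rightarrow> nat \<Rightarrow> nat \<Rightarrow> real" where
  "P0_L M X k1 k2 n = \<P>(\<omega> in M. N0 X k2 \<omega> = enat n \<and> N1 X k1 \<omega> < enat n)"

text \<open>
  Tuples \<open>(x 1, \<dots>, x s)\<close> of positive integers with sum \<open>u\<close>, as extensional functions on \<open>{1..s}\<close>,
  so that distinct functions are distinct tuples and there is exactly one empty tuple.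
\<close>

definition pos_tuples :: "nat \<Rightarrow> nat \<Rightarrow> (nat \<Rightarrow> nat) set" where
  "pos_tuples s u = {x \<in> {1..s} \<rightarrow>\<^sub>E {1..}. (\<Sum>j=1..s. x j) = u}"

lemma finite_pos_tuples: "finite (pos_tuples s u)"
proof (rule finite_subset)
  show "pos_tuples s u \<subseteq> {1..s} \<rightarrow>\<^sub>E {..u}"
  proof
    fix x assume x: "x \<in> pos_tuples s u"
    have "x j \<le> u" if "j \<in> {1..s}" for j
      using member_le_sum[of j "{1..s}" x] that x by (simp add: pos_tuples_def)
    with x show "x \<in> {1..s} \<rightarrow>\<^sub>E {..u}"
      by (auto simp: pos_tuples_def PiE_iff)
  qed
  show "finite ({1..s} \<rightarrow>\<^sub>E {..u})"
    by (simp add: finite_PiE)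
qed

definition I_bar :: "real \<Rightarrow> nat \<Rightarrow> nat \<Rightarrow> nat \<Rightarrow> real" where
  "I_bar q u v s = (\<Sum>(x, y) \<in> pos_tuples s u \<times> pos_tuples (s - 1) v.
     q ^ (\<Sum>j=2..s. (\<Sum>i=1..j-1. y i) * x j))"

definition J_bar :: "real \<Rightarrow> nat \<Rightarrow> nat \<Rightarrow> nat \<Rightarrow> real" where
  "J_bar q u v s = (\<Sum>(x, y) \<in> pos_tuples s u \<times> pos_tuples s v.
     q ^ (\<Sum>j=1..s. (\<Sum>i=1..j. y i) * x j))"

definition K_bar :: "real \<Rightarrow> nat \<Rightarrow> nat \<Rightarrow> nat \<Rightarrow> real" where
  "K_bar q u v s = (\<Sum>(x, y) \<in> pos_tuples (s - 1) u \<times> pos_tuples s v.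
     q ^ (\<Sum>j=1..s-1. (\<Sum>i=1..j. y i) * x j))"

definition L_bar :: "real \<Rightarrow> nat \<Rightarrow> nat \<Rightarrow> nat \<Rightarrow> real" where
  "L_bar q u v s = (\<Sum>(x, y) \<in> pos_tuples s u \<times> pos_tuples s v.
     q ^ (\<Sum>j=2..s. (\<Sum>i=1..j-1. y i) * x j))"

end

theory Submission
  imports Defs
begin

text \<open>
  A path with \<open>u\<close> successes and \<open>v\<close> failures has probability
  \<open>\<theta> ^ u * (\<Prod>j=1..v. 1 - \<theta> * q ^ (j - 1)) * q ^ e\<close>, where \<open>e\<close> counts the pairs consisting of a success
  and an earlier failure: every success contributes one factor \<open>q\<close> for each failure before it, and the
  \<open>j\<close>-th failure has probability \<open>1 - \<theta> * q ^ (j - 1)\<close> wherever it occurs. The theorem thus amounts to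
  computing the generating function of \<open>e\<close> over words with a given last letter. Cutting a word into
  maximal runs, with success runs of lengths \<open>x 1, x 2, \<dots>\<close> and failure runs of lengths \<open>y 1, y 2, \<dots>\<close>,
  gives the four sums of the statement, according to the first and last letter:
  \<^item> \<^const>\<open>I_bar\<close>: \<open>x 1, y 1, \<dots>, y (s - 1), x s\<close>, starting and ending with a success;
  \<^item> \<^const>\<open>J_bar\<close>: \<open>y 1, x 1, \<dots>, y s, x s\<close>, starting with a failure, ending with a success;
  \<^item> \<^const>\<open>K_bar\<close>: \<open>y 1, x 1, \<dots>, x (s - 1), y s\<close>, starting and ending with a failure;
  \<^item> \<^const>\<open>L_bar\<close>: \<open>x 1, y 1, \<dots>, x s, y s\<close>, starting with a success, ending with a failure.

  Instead of constructing a bijection between words and pairs of tuples, the proof shows that both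
  sides obey the same recursion, obtained by deleting the last letter. For the sums, the last run
  either shrinks by one or, if it has length one, disappears, so that the word ends with the run
  before it (\<open>I_bar_Suc\<close>, \<open>J_bar_Suc\<close>, \<open>K_bar_Suc\<close>, \<open>L_bar_Suc\<close>). A deleted success
  costs a factor \<open>q ^ v\<close>, as all \<open>v\<close> failures precede it; a deleted failure costs nothing. For
  the probabilities, the recursion is the Markov property of the number of failures
  (\<open>prob_next_success\<close>, \<open>prob_next_failure\<close>). Induction on the number of trials gives the joint law of
  the number of failures and the last letter (\<open>prob_failures\<close>).

  This suffices because the events on the waiting times only involve these data: \<open>N1 = n\<close> and
  \<open>N0 < n\<close> hold together if and only if trial \<open>n\<close> is a success and exactly \<open>n - k1\<close> of the earlier trials
  are failures, since \<open>k1 + k2 \<le> n\<close> says that these failures reach the quota \<open>k2\<close>. Finally, \<open>N1\<close> and \<open>N0\<close>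
  cannot both be \<open>n\<close>, so the event that their maximum is \<open>n\<close> splits into two disjoint parts.
\<close>

section \<open>Sums over compositions\<close>

lemma pos_tuples_0: "pos_tuples 0 u = (if u = 0 then {\<lambda>_. undefined} else {})"
  by (auto simp: pos_tuples_def)

lemma pos_tuples_empty:
  assumes "u < s"
  shows "pos_tuples s u = {}"
proof -
  have False if "x \<in> pos_tuples s u" for x
  proof -
    have "(\<Sum>j=1..s. 1) \<le> (\<Sum>j=1..s. x j)"
      using that by (intro sum_mono) (auto simp: pos_tuples_def PiE_iff)
    with that assms show False by (simp add: pos_tuples_def)
  qed
  then show ?thesis by blast
qed

text \<open>
  The last part is either at least 2, and can be decreased by one, or equal to 1, and can be removed.
  This is what deleting the last letter does to the lengths of the runs of that letter.
\<close>

lemma sum_pos_tuples_Suc: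
  fixes f :: "(nat \<Rightarrow> nat) \<Rightarrow> real"
  shows "(\<Sum>x\<in>pos_tuples (Suc s) (Suc u). f x) =
    (\<Sum>x\<in>pos_tuples (Suc s) u. f (x(Suc s := Suc (x (Suc s))))) +
    (\<Sum>x\<in>pos_tuples s u. f (x(Suc s := 1)))"
proof -
  let ?T = "pos_tuples (Suc s) (Suc u)"
  have "(\<Sum>x\<in>?T. f x) = (\<Sum>x\<in>{x\<in>?T. x (Suc s) \<noteq> 1}. f x) + (\<Sum>x\<in>{x\<in>?T. x (Suc s) = 1}. f x)"
    by (subst sum.union_disjoint[symmetric]) (auto simp: finite_pos_tuples intro!: sum.cong)
  moreover have "(\<Sum>x\<in>{x\<in>?T. x (Suc s) \<noteq> 1}. f x) =
      (\<Sum>x\<in>pos_tuples (Suc s) u. f (x(Suc s := Suc (x (Suc s)))))"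
  proof (rule sum.reindex_bij_witness[where j = "\<lambda>x. x(Suc s := x (Suc s) - 1)"
        and i = "\<lambda>x. x(Suc s := Suc (x (Suc s)))"], goal_cases)
    case (1 x)
    then have "1 \<le> x (Suc s)" by (auto simp: pos_tuples_def PiE_iff)
    then show ?case by auto
  next
    case (2 x)
    then have "1 \<le> x (Suc s)" by (auto simp: pos_tuples_def PiE_iff)
    with 2 show ?case by (auto simp: pos_tuples_def PiE_iff extensional_def le_Suc_eq)
  next
    case (3 x)
    then show ?case by auto
  next
    case (4 x)
    then have "1 \<le> x (Suc s)" by (auto simp: pos_tuples_def PiE_iff)
    with 4 show ?case by (auto simp: pos_tuples_def PiE_iff extensional_def le_Suc_eq)
  next
    case (5 x)
    then have "1 \<le> x (Suc s)" by (auto simp: pos_tuples_def PiE_iff)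
    then show ?case by auto
  qed
  moreover have "(\<Sum>x\<in>{x\<in>?T. x (Suc s) = 1}. f x) = (\<Sum>x\<in>pos_tuples s u. f (x(Suc s := 1)))"
  proof (rule sum.reindex_bij_witness[where j = "\<lambda>x. x(Suc s := undefined)"
        and i = "\<lambda>x. x(Suc s := 1)"], goal_cases)
    \<comment> \<open>Extensionality on \<open>{1..s}\<close> forces the value \<open>undefined\<close> at \<open>Suc s\<close> once the part is removed.\<close>
    case (1 x)
    then show ?case by auto
  next
    case (2 x)
    then show ?case by (auto simp: pos_tuples_def PiE_iff extensional_def le_Suc_eq)
  next
    case (3 x)
    then have "x (Suc s) = undefined" by (auto simp: pos_tuples_def PiE_iff extensional_def)
    then show ?case by auto
  next
    case (4 x)
    then show ?case by (auto simp: pos_tuples_def PiE_iff extensional_def le_Suc_eq)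
  next
    case (5 x)
    then show ?case by (simp add: fun_upd_idem)
  qed
  ultimately show ?thesis by simp
qed

section \<open>Removing the last letter\<close>

text \<open>
  Only the last summand of the exponent involves the last success run, and there this run is
  multiplied by the sum of all failure runs, which is \<open>v\<close>. Shortening the run by one therefore
  takes out \<open>q ^ v\<close>. If the run disappears, the word ends with failure run \<open>s\<close> and is counted by
  \<^const>\<open>L_bar\<close>. For \<open>s = 0\<close> this is the empty word: \<open>L_bar q u v 0\<close> is 1 if \<open>u = v = 0\<close> and 0 otherwise.
\<close>

lemma I_bar_Suc: "I_bar q (Suc u) v (Suc s) = q ^ v * (I_bar q u v (Suc s) + L_bar q u v s)"
proof -
  define e where "e n x y = (\<Sum>j=2..n. (\<Sum>i=1..j-1. y i) * x j)" for n and x y :: "nat \<Rightarrow> nat"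
  have top: "e (Suc s) x y = e s x y + v * x (Suc s)" if "y \<in> pos_tuples s v" for x y
    using that by (cases s) (auto simp: e_def pos_tuples_def)
  have low: "e s (x(Suc s := c)) y = e s x y" for x y c
    unfolding e_def by (intro sum.cong) auto
  have "I_bar q (Suc u) v (Suc s) =
      (\<Sum>y\<in>pos_tuples s v. \<Sum>x\<in>pos_tuples (Suc s) (Suc u). q ^ e (Suc s) x y)"
    unfolding I_bar_def e_def by (subst sum.cartesian_product[symmetric], subst sum.swap) simp
  also have "\<dots> = (\<Sum>y\<in>pos_tuples s v. q ^ v * ((\<Sum>x\<in>pos_tuples (Suc s) u. q ^ e (Suc s) x y) +
      (\<Sum>x\<in>pos_tuples s u. q ^ e s x y)))"
    by (intro sum.cong refl, unfold sum_pos_tuples_Suc)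
       (simp add: top low power_add sum_distrib_left algebra_simps)
  also have "\<dots> = q ^ v * ((\<Sum>x\<in>pos_tuples (Suc s) u. \<Sum>y\<in>pos_tuples s v. q ^ e (Suc s) x y) +
      (\<Sum>x\<in>pos_tuples s u. \<Sum>y\<in>pos_tuples s v. q ^ e s x y))"
    by (simp add: sum_distrib_left[symmetric] sum.distrib sum.swap[of _ "pos_tuples s v"])
  also have "\<dots> = q ^ v * (I_bar q u v (Suc s) + L_bar q u v s)"
    unfolding I_bar_def L_bar_def e_def by (simp add: sum.cartesian_product)
  finally show ?thesis .
qed

lemma J_bar_Suc: "J_bar q (Suc u) v (Suc s) = q ^ v * (J_bar q u v (Suc s) + K_bar q u v (Suc s))"
proof -
  define e where "e n x y = (\<Sum>j=1..n. (\<Sum>i=1..j. y i) * x j)" for n and x y :: "nat \<Rightarrow> nat"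
  have top: "e (Suc s) x y = e s x y + v * x (Suc s)" if "y \<in> pos_tuples (Suc s) v" for x y
    using that by (auto simp: e_def pos_tuples_def)
  have low: "e s (x(Suc s := c)) y = e s x y" for x y c
    unfolding e_def by (intro sum.cong) auto
  let ?Y = "pos_tuples (Suc s) v"
  have "J_bar q (Suc u) v (Suc s) =
      (\<Sum>y\<in>?Y. \<Sum>x\<in>pos_tuples (Suc s) (Suc u). q ^ e (Suc s) x y)"
    unfolding J_bar_def e_def by (subst sum.cartesian_product[symmetric], subst sum.swap) simp
  also have "\<dots> = (\<Sum>y\<in>?Y. q ^ v * ((\<Sum>x\<in>pos_tuples (Suc s) u. q ^ e (Suc s) x y) +
      (\<Sum>x\<in>pos_tuples s u. q ^ e s x y)))"
    by (intro sum.cong refl, unfold sum_pos_tuples_Suc)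
       (simp add: top low power_add sum_distrib_left algebra_simps)
  also have "\<dots> = q ^ v * ((\<Sum>x\<in>pos_tuples (Suc s) u. \<Sum>y\<in>?Y. q ^ e (Suc s) x y) +
      (\<Sum>x\<in>pos_tuples s u. \<Sum>y\<in>?Y. q ^ e s x y))"
    by (simp add: sum_distrib_left[symmetric] sum.distrib sum.swap[of _ ?Y])
  also have "\<dots> = q ^ v * (J_bar q u v (Suc s) + K_bar q u v (Suc s))"
    unfolding J_bar_def K_bar_def e_def by (simp add: sum.cartesian_product)
  finally show ?thesis .
qed

text \<open>
  The exponent counts the failures before each success, so it does not involve the final failure
  run. Hence neither shortening nor deleting that run changes it.
\<close>

lemma K_bar_Suc: "K_bar q u (Suc v) (Suc s) = K_bar q u v (Suc s) + J_bar q u v s"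
proof -
  define e where "e x y = (\<Sum>j=1..s. (\<Sum>i=1..j. y i) * x j)" for x y :: "nat \<Rightarrow> nat"
  have upd: "e x (y(Suc s := c)) = e x y" for x y c
    unfolding e_def by (intro sum.cong arg_cong2[where f = "(*)"]) auto
  have "K_bar q u (Suc v) (Suc s) =
      (\<Sum>x\<in>pos_tuples s u. \<Sum>y\<in>pos_tuples (Suc s) (Suc v). q ^ e x y)"
    unfolding K_bar_def e_def by (simp add: sum.cartesian_product)
  also have "\<dots> = (\<Sum>x\<in>pos_tuples s u. \<Sum>y\<in>pos_tuples (Suc s) v. q ^ e x y) +
      (\<Sum>x\<in>pos_tuples s u. \<Sum>y\<in>pos_tuples s v. q ^ e x y)"
    unfolding sum_pos_tuples_Suc by (simp add: upd sum.distrib)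
  also have "\<dots> = K_bar q u v (Suc s) + J_bar q u v s"
    unfolding K_bar_def J_bar_def e_def by (simp add: sum.cartesian_product)
  finally show ?thesis .
qed

lemma L_bar_Suc: "L_bar q u (Suc v) (Suc s) = L_bar q u v (Suc s) + I_bar q u v (Suc s)"
proof -
  define e where "e x y = (\<Sum>j=2..Suc s. (\<Sum>i=1..j-1. y i) * x j)" for x y :: "nat \<Rightarrow> nat"
  have upd: "e x (y(Suc s := c)) = e x y" for x y c
    unfolding e_def by (intro sum.cong arg_cong2[where f = "(*)"]) auto
  let ?X = "pos_tuples (Suc s) u"
  have "L_bar q u (Suc v) (Suc s) = (\<Sum>x\<in>?X. \<Sum>y\<in>pos_tuples (Suc s) (Suc v). q ^ e x y)"
    unfolding L_bar_def e_def by (simp add: sum.cartesian_product)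
  also have "\<dots> = (\<Sum>x\<in>?X. \<Sum>y\<in>pos_tuples (Suc s) v. q ^ e x y) +
      (\<Sum>x\<in>?X. \<Sum>y\<in>pos_tuples s v. q ^ e x y)"
    unfolding sum_pos_tuples_Suc by (simp add: upd sum.distrib)
  also have "\<dots> = L_bar q u v (Suc s) + I_bar q u v (Suc s)"
    unfolding L_bar_def I_bar_def e_def by (simp add: sum.cartesian_product)
  finally show ?thesis .
qed

section \<open>Inversion generating functions of binary words\<close>

text \<open>
  The next two sums run over the words with \<open>u\<close> successes and \<open>v\<close> failures that end with the named
  letter, and the third over all words with these counts; the extra 1 is the empty word, which has no
  last letter. The weight of a word is \<open>q\<close> to the number of pairs of a success and an earlier failure.
\<close>

definition gf_last_success :: "real \<Rightarrow> nat \<Rightarrow> nat \<Rightarrow> real" where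
  "gf_last_success q u v = (\<Sum>s=1..u. I_bar q u v s + J_bar q u v s)"

definition gf_last_failure :: "real \<Rightarrow> nat \<Rightarrow> nat \<Rightarrow> real" where
  "gf_last_failure q u v = (\<Sum>s=1..v. K_bar q u v s + L_bar q u v s)"

definition gf_words :: "real \<Rightarrow> nat \<Rightarrow> nat \<Rightarrow> real" where
  "gf_words q u v = of_bool (u = 0 \<and> v = 0) + gf_last_success q u v + gf_last_failure q u v"

text \<open>
  A word with \<open>u\<close> successes has at most \<open>u\<close> runs of successes, so the upper bound for the number of runs
  may be raised. With a common bound, sums that come from different run patterns can be added termwise.
\<close>

lemma gf_last_success_upto:
  assumes "u \<le> N"
  shows "gf_last_success q u v = (\<Sum>s<N. I_bar q u v (Suc s) + J_bar q u v (Suc s))"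
proof -
  have "gf_last_success q u v = (\<Sum>s<u. I_bar q u v (Suc s) + J_bar q u v (Suc s))"
    unfolding gf_last_success_def
    by (simp add: sum.atLeast1_atMost_eq)
  also have "\<dots> = (\<Sum>s<N. I_bar q u v (Suc s) + J_bar q u v (Suc s))"
    using assms
    by (intro sum.mono_neutral_left) (auto simp: I_bar_def J_bar_def pos_tuples_empty)
  finally show ?thesis .
qed

lemma gf_last_failure_upto:
  assumes "v \<le> N"
  shows "gf_last_failure q u v = (\<Sum>s<N. K_bar q u v (Suc s) + L_bar q u v (Suc s))"
proof -
  have "gf_last_failure q u v = (\<Sum>s<v. K_bar q u v (Suc s) + L_bar q u v (Suc s))"
    unfolding gf_last_failure_def
    by (simp add: sum.atLeast1_atMost_eq)
  also have "\<dots> = (\<Sum>s<N. K_bar q u v (Suc s) + L_bar q u v (Suc s))"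
    using assms
    by (intro sum.mono_neutral_left) (auto simp: K_bar_def L_bar_def pos_tuples_empty)
  finally show ?thesis .
qed

text \<open>
  Deleting the final success leaves an arbitrary word with one success less. The term \<open>s = 0\<close> of the
  shifted sum of \<^const>\<open>L_bar\<close> is the contribution of the empty word.
\<close>

lemma gf_last_success_Suc: "gf_last_success q (Suc u) v = q ^ v * gf_words q u v"
proof -
  define m where "m = u + v"
  have le: "Suc u \<le> Suc m" "u \<le> Suc m" "v \<le> Suc m" by (simp_all add: m_def)
  have "L_bar q u v (Suc m) = 0"
    by (simp add: L_bar_def m_def pos_tuples_empty)
  then have L: "(\<Sum>s<Suc m. L_bar q u v s) = L_bar q u v 0 + (\<Sum>s<Suc m. L_bar q u v (Suc s))"
    by (subst sum.lessThan_Suc_shift) simp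
  have "L_bar q u v 0 = of_bool (u = 0 \<and> v = 0)"
    by (simp add: L_bar_def pos_tuples_0)
  with L show ?thesis
    unfolding gf_words_def gf_last_success_upto[OF le(1)] gf_last_success_upto[OF le(2)]
      gf_last_failure_upto[OF le(3)]
    by (simp add: I_bar_Suc J_bar_Suc sum.distrib sum_distrib_left[symmetric] algebra_simps
        del: sum.lessThan_Suc)
qed

lemma gf_last_failure_Suc: "gf_last_failure q u (Suc v) = gf_words q u v"
proof -
  define m where "m = u + v"
  have le: "Suc v \<le> Suc m" "u \<le> Suc m" "v \<le> Suc m" by (simp_all add: m_def)
  have "J_bar q u v (Suc m) = 0"
    by (simp add: J_bar_def m_def pos_tuples_empty)
  then have J: "(\<Sum>s<Suc m. J_bar q u v s) = J_bar q u v 0 + (\<Sum>s<Suc m. J_bar q u v (Suc s))"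
    by (subst sum.lessThan_Suc_shift) simp
  have "J_bar q u v 0 = of_bool (u = 0 \<and> v = 0)"
    by (simp add: J_bar_def pos_tuples_0)
  with J show ?thesis
    unfolding gf_words_def gf_last_failure_upto[OF le(1)] gf_last_success_upto[OF le(2)]
      gf_last_failure_upto[OF le(3)]
    by (simp add: K_bar_Suc L_bar_Suc sum.distrib algebra_simps del: sum.lessThan_Suc)
qed

section \<open>Occurrence times\<close>

definition occurrences :: "nat \<Rightarrow> (nat \<Rightarrow> nat) \<Rightarrow> nat \<Rightarrow> nat" where
  "occurrences b x n = card {j\<in>{1..n}. x j = b}"

lemma occurrences_0: "occurrences b x 0 = 0"
  by (simp add: occurrences_def)

lemma occurrences_Suc: "occurrences b x (Suc n) = occurrences b x n + of_bool (x (Suc n) = b)"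
proof -
  have "{j\<in>{1..Suc n}. x j = b} =
      (if x (Suc n) = b then insert (Suc n) {j\<in>{1..n}. x j = b} else {j\<in>{1..n}. x j = b})"
    by (auto simp: le_Suc_eq)
  then show ?thesis by (simp add: occurrences_def)
qed

lemma occurrences_mono: "m \<le> n \<Longrightarrow> occurrences b x m \<le> occurrences b x n"
  by (rule lift_Suc_mono_le) (simp_all add: occurrences_Suc)

lemma occurrences_strict:
  assumes "m < n" "x n = b"
  shows "occurrences b x m < occurrences b x n"
proof (cases n)
  case (Suc n')
  with assms have "occurrences b x m \<le> occurrences b x n'" by (intro occurrences_mono) simp
  with Suc assms show ?thesis by (simp add: occurrences_Suc)
qed (use assms in simp)

lemma occurrences_binary:
  assumes "\<And>j. 1 \<le> j \<Longrightarrow> x j \<in> {0, 1}"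
  shows "occurrences 0 x n + occurrences 1 x n = n"
proof (induction n)
  case (Suc n)
  then show ?case using assms[of "Suc n"] by (auto simp: occurrences_Suc)
qed (simp add: occurrences_0)

text \<open>The counting function starts at 0 and has steps of size at most 1, so it skips no value.\<close>

lemma occurrences_attained:
  assumes "1 \<le> k" "k \<le> occurrences b x n"
  shows "\<exists>m. 1 \<le> m \<and> m \<le> n \<and> x m = b \<and> occurrences b x m = k"
  using assms(2)
proof (induction n)
  case 0
  with assms(1) show ?case by (simp add: occurrences_0)
next
  case (Suc n)
  show ?case
  proof (cases "k \<le> occurrences b x n")
    case True
    with Suc.IH show ?thesis using le_SucI by blast
  next
    case False
    with Suc.prems show ?thesis
      by (intro exI[of _ "Suc n"]) (auto simp: occurrences_Suc of_bool_def split: if_splits)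
  qed
qed

lemma occurrence_time_eqI:
  assumes "1 \<le> n" "x n = b" "occurrences b x n = k"
  shows "occurrence_time b k x = enat n"
proof -
  have uniq: "m = n" if "x m = b" "occurrences b x m = k" for m
    using occurrences_strict[of m n x b] occurrences_strict[of n m x b] that assms
    by (cases m n rule: linorder_cases) auto
  have "{n. 1 \<le> n \<and> x n = b \<and> occurrences b x n = k} = {n}"
    using assms uniq by blast
  then show ?thesis by (simp add: occurrence_time_def occurrences_def)
qed

lemma occurrence_time_finite:
  assumes "occurrence_time b k x \<noteq> \<infinity>"
  shows "\<exists>n. 1 \<le> n \<and> x n = b \<and> occurrences b x n = k"
proof (rule ccontr)
  assume "\<not> ?thesis"
  then have "{n. 1 \<le> n \<and> x n = b \<and> card {j\<in>{1..n}. x j = b} = k} = {}"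
    by (auto simp: occurrences_def)
  with assms show False by (simp only: occurrence_time_def) (simp add: top_enat_def)
qed

lemma occurrence_time_eq_iff:
  "occurrence_time b k x = enat n \<longleftrightarrow> 1 \<le> n \<and> x n = b \<and> occurrences b x n = k"
proof
  assume t: "occurrence_time b k x = enat n"
  then obtain m where "1 \<le> m" "x m = b" "occurrences b x m = k"
    using occurrence_time_finite[of b k x] by auto
  with occurrence_time_eqI[of m x b k] t
  show "1 \<le> n \<and> x n = b \<and> occurrences b x n = k" by simp
qed (use occurrence_time_eqI[of n x b k] in blast)

lemma occurrence_time_le_iff:
  assumes "1 \<le> k"
  shows "occurrence_time b k x \<le> enat n \<longleftrightarrow> k \<le> occurrences b x n"
proof
  assume t: "occurrence_time b k x \<le> enat n"
  then obtain m where m: "occurrence_time b k x = enat m"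
    by (metis enat_ile)
  with occurrence_time_eq_iff[of b k x m] have "occurrences b x m = k" by simp
  moreover have "m \<le> n" using m t by simp
  ultimately show "k \<le> occurrences b x n" using occurrences_mono by blast
next
  assume "k \<le> occurrences b x n"
  with assms obtain m where "1 \<le> m" "m \<le> n" "x m = b" "occurrences b x m = k"
    using occurrences_attained by blast
  then show "occurrence_time b k x \<le> enat n"
    using occurrence_time_eqI[of m x b k] by simp
qed

lemma occurrence_time_less_Suc_iff:
  assumes "1 \<le> k"
  shows "occurrence_time b k x < enat (Suc n) \<longleftrightarrow> k \<le> occurrences b x n"
proof -
  have "t < enat (Suc n) \<longleftrightarrow> t \<le> enat n" for t
    by (cases t) auto
  then show ?thesis using occurrence_time_le_iff[OF assms] by simp
qed

section \<open>The number of failures\<close>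

context q_bernoulli_trials
begin

abbreviation failures :: "nat \<Rightarrow> 'a \<Rightarrow> nat" where
  "failures n \<omega> \<equiv> occurrences 0 (\<lambda>j. X j \<omega>) n"

lemma event_X: "1 \<le> j \<Longrightarrow> {\<omega>\<in>space M. X j \<omega> = b} \<in> events"
  using measurable_sets[OF X_measurable, of j "{b}"]
  by (simp add: vimage_def Int_def conj_commute)

lemma event_history: "{\<omega>\<in>space M. \<forall>l\<in>{1..<Suc m}. X l \<omega> = x l} \<in> events"
  by (intro sets.sets_Collect_finite_All event_X) auto

lemma event_failures: "{\<omega>\<in>space M. failures n \<omega> = v} \<in> events"
proof (induction n arbitrary: v)
  case 0
  show ?case by (cases "v = 0") (simp_all add: occurrences_0)
next
  case (Suc n)
  have "{\<omega>\<in>space M. failures (Suc n) \<omega> = v} =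
    {\<omega>\<in>space M. (X (Suc n) \<omega> = 0 \<and> failures n \<omega> = v - 1 \<and> 1 \<le> v) \<or>
      (\<not> X (Suc n) \<omega> = 0 \<and> failures n \<omega> = v)}"
    by (auto simp: occurrences_Suc)
  also have "\<dots> \<in> events"
    by (intro sets.sets_Collect_disj sets.sets_Collect_conj sets.sets_Collect_neg event_X Suc.IH
        sets.sets_Collect_const) simp_all
  finally show ?case .
qed

text \<open>
  The hypotheses of the locale condition on complete histories. If the conditional probability is
  the same \<open>c\<close> for all histories with \<open>v\<close> failures, then summing over these finitely many disjoint
  histories gives the corresponding statement for the number of failures alone.
\<close>

lemma prob_next_trial:
  assumes cond: "\<And>x. \<P>(\<omega> in M. \<forall>l\<in>{1..<Suc m}. X l \<omega> = x l) > 0 \<Longrightarrow> occurrences 0 x m = v \<Longrightarrow>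
      \<P>(\<omega> in M. X (Suc m) \<omega> = b \<bar> \<forall>l\<in>{1..<Suc m}. X l \<omega> = x l) = c"
  shows "\<P>(\<omega> in M. failures m \<omega> = v \<and> X (Suc m) \<omega> = b) = c * \<P>(\<omega> in M. failures m \<omega> = v)"
proof -
  define H where "H = {x \<in> {1..<Suc m} \<rightarrow>\<^sub>E {0, 1::nat}. occurrences 0 x m = v}"
  define hist where "hist x \<omega> \<longleftrightarrow> (\<forall>l\<in>{1..<Suc m}. X l \<omega> = x l)" for x \<omega>
  have finH: "finite H"
    unfolding H_def by (rule finite_subset[OF _ finite_PiE[of "{1..<Suc m}" "\<lambda>_. {0, 1}"]]) auto
  have hist_failures: "failures m \<omega> = occurrences 0 x m" if "hist x \<omega>" for x \<omega>
    unfolding occurrences_def using that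
    by (intro arg_cong[where f = card]) (auto simp: hist_def)
  have ex1: "\<exists>!x. x \<in> H \<and> hist x \<omega>" if \<omega>: "\<omega> \<in> space M" "failures m \<omega> = v" for \<omega>
  proof (rule ex1I)
    let ?x = "restrict (\<lambda>l. X l \<omega>) {1..<Suc m}"
    have h: "hist ?x \<omega>" by (simp add: hist_def)
    show "?x \<in> H \<and> hist ?x \<omega>"
      using h hist_failures[OF h] X_binary \<omega> by (auto simp: H_def)
    fix x assume "x \<in> H \<and> hist x \<omega>"
    then show "x = ?x"
      by (intro ext) (auto simp: H_def hist_def PiE_iff extensional_def)
  qed
  have ev: "{\<omega>\<in>space M. hist x \<omega>} \<in> events" for x
    unfolding hist_def by (rule event_history)
  have evb: "{\<omega>\<in>space M. X (Suc m) \<omega> = b} \<in> events"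
    by (rule event_X) simp
  have step: "\<P>(\<omega> in M. hist x \<omega> \<and> X (Suc m) \<omega> = b) = c * \<P>(\<omega> in M. hist x \<omega>)" if "x \<in> H" for x
  proof (cases "\<P>(\<omega> in M. hist x \<omega>) > 0")
    case True
    with that have "\<P>(\<omega> in M. X (Suc m) \<omega> = b \<bar> hist x \<omega>) = c"
      using cond[of x] by (simp add: hist_def H_def)
    with True show ?thesis by (simp add: cond_prob_def field_simps conj_commute)
  next
    case False
    \<comment> \<open>Nothing is known about the next trial after a null history, but both sides vanish.\<close>
    then have 0: "\<P>(\<omega> in M. hist x \<omega>) = 0" by (simp add: zero_less_measure_iff)
    have "\<P>(\<omega> in M. hist x \<omega> \<and> X (Suc m) \<omega> = b) \<le> \<P>(\<omega> in M. hist x \<omega>)"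
      by (intro finite_measure_mono ev) auto
    with 0 show ?thesis by (simp add: measure_le_0_iff)
  qed
  have "\<P>(\<omega> in M. failures m \<omega> = v \<and> X (Suc m) \<omega> = b) =
      (\<Sum>x\<in>H. \<P>(\<omega> in M. hist x \<omega> \<and> X (Suc m) \<omega> = b))"
    by (intro prob_sum finH sets.sets_Collect_conj ev evb event_failures AE_I2)
       (use ex1 hist_failures in \<open>auto simp: H_def\<close>)
  also have "\<dots> = c * (\<Sum>x\<in>H. \<P>(\<omega> in M. hist x \<omega>))"
    by (simp add: step sum_distrib_left)
  also have "(\<Sum>x\<in>H. \<P>(\<omega> in M. hist x \<omega>)) = \<P>(\<omega> in M. failures m \<omega> = v)"
    by (intro prob_sum[symmetric] finH ev event_failures AE_I2)
       (use ex1 hist_failures in \<open>auto simp: H_def\<close>)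
  finally show ?thesis .
qed

lemma prob_next_success:
  "\<P>(\<omega> in M. failures m \<omega> = v \<and> X (Suc m) \<omega> = 1) = \<theta> * q ^ v * \<P>(\<omega> in M. failures m \<omega> = v)"
  by (rule prob_next_trial, subst cond_success)
     (auto simp: occurrences_def atLeastLessThanSuc_atLeastAtMost)

lemma prob_next_failure:
  "\<P>(\<omega> in M. failures m \<omega> = v \<and> X (Suc m) \<omega> = 0) = (1 - \<theta> * q ^ v) * \<P>(\<omega> in M. failures m \<omega> = v)"
  by (rule prob_next_trial, subst cond_failure)
     (auto simp: occurrences_def atLeastLessThanSuc_atLeastAtMost)

text \<open>The part of the probability of a path that does not depend on the order of its letters.\<close>

definition weight :: "nat \<Rightarrow> nat \<Rightarrow> real" where
  "weight u v = \<theta> ^ u * (\<Prod>j=1..v. 1 - \<theta> * q ^ (j - 1))"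

text \<open>
  The passage from the law of the number of failures in \<open>u + v\<close> trials to its joint law with the next
  trial is stated with the former as a hypothesis, since the induction in \<open>prob_failures\<close> uses it.
\<close>

lemma prob_last_success_aux:
  assumes "\<P>(\<omega> in M. failures (u + v) \<omega> = v) = weight u v * gf_words q u v"
  shows "\<P>(\<omega> in M. failures (u + v) \<omega> = v \<and> X (Suc (u + v)) \<omega> = 1) =
    weight (Suc u) v * gf_last_success q (Suc u) v"
  unfolding prob_next_success assms gf_last_success_Suc by (simp add: weight_def)

lemma prob_last_failure_aux:
  assumes "\<P>(\<omega> in M. failures (u + v) \<omega> = v) = weight u v * gf_words q u v"
  shows "\<P>(\<omega> in M. failures (u + v) \<omega> = v \<and> X (Suc (u + v)) \<omega> = 0) =
    weight u (Suc v) * gf_last_failure q u (Suc v)"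
  unfolding prob_next_failure assms gf_last_failure_Suc by (simp add: weight_def)

text \<open>
  The induction splits by the outcome of the last trial. In the boundary cases \<open>u = 0\<close> (last trial a
  success) and \<open>v = 0\<close> (last trial a failure) there is no such path, and the generating function is an
  empty sum.
\<close>

lemma prob_failures:
  "\<P>(\<omega> in M. failures (u + v) \<omega> = v) = weight u v * gf_words q u v"
proof (induction "u + v" arbitrary: u v)
  case 0
  then show ?case
    by (simp add: occurrences_0 prob_space weight_def gf_words_def gf_last_success_def
        gf_last_failure_def)
next
  case (Suc m)
  have S: "\<P>(\<omega> in M. failures m \<omega> = v \<and> X (Suc m) \<omega> = 1) = weight u v * gf_last_success q u v"
  proof (cases u)
    case 0
    have "failures m \<omega> \<noteq> v" if "\<omega> \<in> space M" for \<omega>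
      using occurrences_binary[of "\<lambda>j. X j \<omega>" m] X_binary that 0 Suc.hyps(2) by fastforce
    then have "{\<omega>\<in>space M. failures m \<omega> = v \<and> X (Suc m) \<omega> = 1} = {}" by blast
    then have "\<P>(\<omega> in M. failures m \<omega> = v \<and> X (Suc m) \<omega> = 1) = 0"
      by (simp only: measure_empty)
    then show ?thesis using 0 by (simp add: gf_last_success_def)
  next
    case (Suc u')
    with \<open>Suc m = u + v\<close> have m: "m = u' + v" by simp
    show ?thesis
      using prob_last_success_aux[OF Suc.hyps(1)[OF m]] Suc m by simp
  qed
  have F: "\<P>(\<omega> in M. failures (Suc m) \<omega> = v \<and> X (Suc m) \<omega> = 0) = weight u v * gf_last_failure q u v"
  proof (cases v)
    case 0
    then have "{\<omega>\<in>space M. failures (Suc m) \<omega> = v \<and> X (Suc m) \<omega> = 0} = {}"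
      by (auto simp: occurrences_Suc)
    then have "\<P>(\<omega> in M. failures (Suc m) \<omega> = v \<and> X (Suc m) \<omega> = 0) = 0"
      by (simp only: measure_empty)
    then show ?thesis using 0 by (simp add: gf_last_failure_def)
  next
    case (Suc v')
    with \<open>Suc m = u + v\<close> have m: "m = u + v'" by simp
    have "{\<omega>\<in>space M. failures (Suc m) \<omega> = v \<and> X (Suc m) \<omega> = 0} =
        {\<omega>\<in>space M. failures m \<omega> = v' \<and> X (Suc m) \<omega> = 0}"
      using Suc by (auto simp: occurrences_Suc)
    then show ?thesis
      using prob_last_failure_aux[OF Suc.hyps(1)[OF m]] Suc m by simp
  qed
  have "{\<omega>\<in>space M. failures (Suc m) \<omega> = v} = {\<omega>\<in>space M. failures m \<omega> = v \<and> X (Suc m) \<omega> = 1} \<union>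
      {\<omega>\<in>space M. failures (Suc m) \<omega> = v \<and> X (Suc m) \<omega> = 0}"
    using X_binary[of "Suc m"] by (fastforce simp: occurrences_Suc)
  moreover have "\<P>(\<omega> in M. failures m \<omega> = v \<and> X (Suc m) \<omega> = 1) +
      \<P>(\<omega> in M. failures (Suc m) \<omega> = v \<and> X (Suc m) \<omega> = 0) =
      prob ({\<omega>\<in>space M. failures m \<omega> = v \<and> X (Suc m) \<omega> = 1} \<union>
      {\<omega>\<in>space M. failures (Suc m) \<omega> = v \<and> X (Suc m) \<omega> = 0})"
    by (intro finite_measure_Union[symmetric] sets.sets_Collect_conj event_failures event_X) auto
  ultimately have "\<P>(\<omega> in M. failures (Suc m) \<omega> = v) =
      weight u v * (gf_last_success q u v + gf_last_failure q u v)"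
    using S F by (simp add: distrib_left)
  also have "gf_last_success q u v + gf_last_failure q u v = gf_words q u v"
    using Suc.hyps(2) by (auto simp: gf_words_def)
  finally show ?case
    using Suc.hyps(2) by simp
qed

lemmas prob_last_success = prob_last_success_aux[OF prob_failures]
lemmas prob_last_failure = prob_last_failure_aux[OF prob_failures]

text \<open>
  If trial \<open>Suc m\<close> is success number \<open>k1\<close>, then \<open>Suc m - k1\<close> failures precede it, and this number is at
  least \<open>k2\<close>. The situation for a final failure is symmetric.
\<close>

lemma P1_L_event:
  assumes "1 \<le> k1" "1 \<le> k2" "k1 + k2 \<le> Suc m"
  shows "{\<omega>\<in>space M. N1 X k1 \<omega> = enat (Suc m) \<and> N0 X k2 \<omega> < enat (Suc m)} =
    {\<omega>\<in>space M. failures m \<omega> = Suc m - k1 \<and> X (Suc m) \<omega> = 1}"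
proof (rule Collect_cong, rule conj_cong[OF refl])
  fix \<omega> assume "\<omega> \<in> space M"
  then have "occurrences 0 (\<lambda>j. X j \<omega>) m + occurrences 1 (\<lambda>j. X j \<omega>) m = m"
    using X_binary by (intro occurrences_binary) auto
  with assms show "(N1 X k1 \<omega> = enat (Suc m) \<and> N0 X k2 \<omega> < enat (Suc m)) =
      (failures m \<omega> = Suc m - k1 \<and> X (Suc m) \<omega> = 1)"
    unfolding N1_def N0_def occurrence_time_eq_iff occurrence_time_less_Suc_iff[OF assms(2)]
      occurrences_Suc
    by auto
qed

lemma P0_L_event:
  assumes "1 \<le> k1" "1 \<le> k2" "k1 + k2 \<le> Suc m"
  shows "{\<omega>\<in>space M. N0 X k2 \<omega> = enat (Suc m) \<and> N1 X k1 \<omega> < enat (Suc m)} =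
    {\<omega>\<in>space M. failures m \<omega> = k2 - 1 \<and> X (Suc m) \<omega> = 0}"
proof (rule Collect_cong, rule conj_cong[OF refl])
  fix \<omega> assume "\<omega> \<in> space M"
  then have "occurrences 0 (\<lambda>j. X j \<omega>) m + occurrences 1 (\<lambda>j. X j \<omega>) m = m"
    using X_binary by (intro occurrences_binary) auto
  with assms show "(N0 X k2 \<omega> = enat (Suc m) \<and> N1 X k1 \<omega> < enat (Suc m)) =
      (failures m \<omega> = k2 - 1 \<and> X (Suc m) \<omega> = 0)"
    unfolding N1_def N0_def occurrence_time_eq_iff occurrence_time_less_Suc_iff[OF assms(1)]
      occurrences_Suc
    by auto
qed

lemma P1_L_eq:
  assumes "1 \<le> k1" "1 \<le> k2" "k1 + k2 \<le> n"
  shows "P1_L M X k1 k2 n = weight k1 (n - k1) * gf_last_success q k1 (n - k1)"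
proof -
  from assms obtain u where u: "k1 = Suc u" by (cases k1) auto
  with assms obtain m where m: "n = Suc m" by (cases n) auto
  have "u + (n - k1) = m" using u m assms by simp
  with prob_last_success[of u "n - k1"] show ?thesis
    using P1_L_event[of k1 k2 m] assms u m by (simp add: P1_L_def)
qed

lemma P0_L_eq:
  assumes "1 \<le> k1" "1 \<le> k2" "k1 + k2 \<le> n"
  shows "P0_L M X k1 k2 n = weight (n - k2) k2 * gf_last_failure q (n - k2) k2"
proof -
  from assms obtain v where v: "k2 = Suc v" by (cases k2) auto
  with assms obtain m where m: "n = Suc m" by (cases n) auto
  have "(n - k2) + v = m" using v m assms by simp
  with prob_last_failure[of "n - k2" v] show ?thesis
    using P0_L_event[of k1 k2 m] assms v m by (simp add: P0_L_def)
qed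

lemma prob_W_L_eq:
  assumes "1 \<le> k1" "1 \<le> k2" "k1 + k2 \<le> n"
  shows "\<P>(\<omega> in M. W_L X k1 k2 \<omega> = enat n) = P1_L M X k1 k2 n + P0_L M X k1 k2 n"
proof -
  from assms obtain m where m: "n = Suc m" by (cases n) auto
  let ?A = "{\<omega>\<in>space M. N1 X k1 \<omega> = enat n \<and> N0 X k2 \<omega> < enat n}"
  let ?B = "{\<omega>\<in>space M. N0 X k2 \<omega> = enat n \<and> N1 X k1 \<omega> < enat n}"
  have "\<not> (N1 X k1 \<omega> = enat n \<and> N0 X k2 \<omega> = enat n)" for \<omega>
    by (auto simp: N1_def N0_def occurrence_time_eq_iff)
  then have "{\<omega>\<in>space M. W_L X k1 k2 \<omega> = enat n} = ?A \<union> ?B"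
    by (auto simp: W_L_def max_def not_le)
  moreover have "?A \<in> events" "?B \<in> events"
    using assms m P1_L_event[of k1 k2 m] P0_L_event[of k1 k2 m]
    by (auto intro!: sets.sets_Collect_conj event_failures event_X)
  moreover have "?A \<inter> ?B = {}" by auto
  ultimately show ?thesis
    by (simp add: finite_measure_Union P1_L_def P0_L_def)
qed

end

theorem theorem5p3:
  fixes M :: "'a measure" and X :: "nat \<Rightarrow> 'a \<Rightarrow> nat"
    and q \<theta> :: real and k1 k2 n :: nat
  assumes "0 \<le> \<theta>" and "\<theta> \<le> 1" and "0 < q" and "q < 1"
    and "q_bernoulli_trials M X q \<theta>"
    and "1 \<le> k1" and "1 \<le> k2" and "k1 + k2 \<le> n"
  shows "\<P>(\<omega> in M. W_L X k1 k2 \<omega> = enat n) = P1_L M X k1 k2 n + P0_L M X k1 k2 n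
    \<and> P1_L M X k1 k2 n = \<theta> ^ k1 * (\<Prod>j=1..n-k1. 1 - \<theta> * q ^ (j - 1))
        * (\<Sum>s=1..k1. I_bar q k1 (n - k1) s + J_bar q k1 (n - k1) s)
    \<and> P0_L M X k1 k2 n = \<theta> ^ (n - k2) * (\<Prod>j=1..k2. 1 - \<theta> * q ^ (j - 1))
        * (\<Sum>s=1..k2. K_bar q (n - k2) k2 s + L_bar q (n - k2) k2 s)"
proof -
  interpret q_bernoulli_trials M X q \<theta> by fact
  show ?thesis
    using prob_W_L_eq[OF assms(6-8)] P1_L_eq[OF assms(6-8)] P0_L_eq[OF assms(6-8)]
    by (simp add: weight_def gf_last_success_def gf_last_failure_def)
qed

end
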